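(* Let $d:\mathcal{A}\to A$ be a $\rho_\theta$-covariant derivation. Then there exists a unique function $\beta\in c_{inc}(\mathbb{Z})$ such that $d(a)=[U\beta(\mathbb{K}),a]$ for all $a\in\mathcal{A}$. If moreover $d:\mathcal{A}\to\mathcal{A}$ (i.e. $d(\mathcal{A})\subset\mathcal{A}$), then the corresponding function $\beta$ is eventually linear.
   Context: Let $\{E_k\}_{k\in\mathbb{Z}}$ be the canonical basis of $\ell^2(\mathbb{Z})$, $UE_k=E_{k+1}$ the bilateral shift, and for $a:\mathbb{Z}\to\mathbb{C}$ let $a(\mathbb{K})$ be the (possibly unbounded) diagonal operator $a(\mathbb{K})E_k=a(k)E_k$; $\mathbb{K}E_k=kE_k$. Fix $0<r<1$ and let $U_rE_k=rE_{k+1}$ for $k<0$, $U_rE_k=E_{k+1}$ for $k\ge0$. The quantum annulus is the unital C$^*$-algebra $A=C^*(U_r)$ of operators on $\ell^2(\mathbb{Z})$. $c(\mathbb{Z})$ is the set of $a:\mathbb{Z}\to\mathbb{C}$ for which both limits $\lim_{k\to\infty}a(k)$ and $\lim_{k\to-\infty}a(k)$ exist (possibly different). $c_{00}^\pm(\mathbb{Z})$ is the set of eventually constant functions: there is $k_0$ such that $a$ is constant on $\{k\ge k_0\}$ and constant on $\{k\le-k_0\}$ (possibly different constants). $c_{inc}(\mathbb{Z})$ is the set of $\beta:\mathbb{Z}\to\mathbb{C}$ with $\{\beta(k)-\beta(k-1)\}_k\in c(\mathbb{Z})$; $\beta$ is eventually linear if $\{\beta(k)-\beta(k-1)\}_k\in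 c_{00}^\pm(\mathbb{Z})$. $\mathcal{A}$ is the dense $*$-subalgebra of $A$ of finite sums $\sum_nU^na_n(\mathbb{K})$ with $a_n\in c_{00}^\pm(\mathbb{Z})$. A derivation $d:\mathcal{A}\to A$ is a linear map with $d(ab)=ad(b)+d(a)b$. For $\theta\in[0,2\pi)$, $\rho_\theta$ is the automorphism of $A$ given by $\rho_\theta(a)=e^{i\theta\mathbb{K}}ae^{-i\theta\mathbb{K}}$ (so $\rho_\theta(U)=e^{i\theta}U$ and $\rho_\theta(a(\mathbb{K}))=a(\mathbb{K})$). A derivation $d:\mathcal{A}\to A$ is $\rho_\theta$-covariant if $d(\rho_\theta(a))=e^{-i\theta}\rho_\theta(d(a))$ for all $a\in\mathcal{A}$ and all $\theta$. The commutator $[U\beta(\mathbb{K}),a]$ is understood as an operator on finite linear combinations of the $E_k$, extended by continuity. *)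

theory Defs
  imports "HOL-Analysis.Analysis"
begin

section \<open>The Hilbert space of square-summable two-sided sequences\<close>

definition square_summable :: "(int \<Rightarrow> complex) \<Rightarrow> bool" where
  "square_summable x \<longleftrightarrow> (\<lambda>k. (cmod (x k))\<^sup>2) summable_on UNIV"

lemma square_summable_zero: "square_summable (\<lambda>_. 0)"
  by (simp add: square_summable_def)

lemma square_summable_bounded_mult:
  assumes "square_summable x" and "\<And>k. cmod (y k) \<le> C * cmod (x k)"
  shows "square_summable y"
  unfolding square_summable_def
proof (rule summable_on_comparison_test)
  show "(\<lambda>k. C\<^sup>2 * (cmod (x k))\<^sup>2) summable_on UNIV"
    using assms(1) unfolding square_summable_def by (rule summable_on_cmult_right)
  show "(cmod (y k))\<^sup>2 \<le> C\<^sup>2 * (cmod (x k))\<^sup>2" for k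
    using power_mono[OF assms(2)[of k], of 2] by (simp add: power_mult_distrib)
qed simp

lemma square_summable_add:
  assumes "square_summable x" "square_summable y"
  shows "square_summable (\<lambda>k. x k + y k)"
  unfolding square_summable_def
proof (rule summable_on_comparison_test)
  show "(\<lambda>k. 2 * (cmod (x k))\<^sup>2 + 2 * (cmod (y k))\<^sup>2) summable_on UNIV"
    using assms unfolding square_summable_def
    by (intro summable_on_add summable_on_cmult_right)
  fix k
  have "(cmod (x k + y k))\<^sup>2 \<le> (cmod (x k) + cmod (y k))\<^sup>2"
    by (intro power_mono norm_triangle_ineq) simp
  also have "\<dots> \<le> 2 * (cmod (x k))\<^sup>2 + 2 * (cmod (y k))\<^sup>2"
    using zero_le_power2[of "cmod (x k) - cmod (y k)"]
    by (simp add: power2_sum power2_diff)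
  finally show "(cmod (x k + y k))\<^sup>2 \<le> 2 * (cmod (x k))\<^sup>2 + 2 * (cmod (y k))\<^sup>2" .
qed simp

lemma square_summable_shift:
  assumes "square_summable x"
  shows "square_summable (\<lambda>k. x (k - n))"
proof -
  have "bij_betw (\<lambda>k. k - n) UNIV (UNIV :: int set)"
    by (rule bij_betwI[of _ _ _ "\<lambda>k. k + n"]) auto
  from summable_on_reindex_bij_betw[OF this, of "\<lambda>k. (cmod (x k))\<^sup>2"]
  show ?thesis using assms by (simp add: square_summable_def)
qed

lemma square_summable_prod:
  assumes "square_summable x" "square_summable y"
  shows "(\<lambda>k. x k * cnj (y k)) summable_on UNIV"
proof (rule abs_summable_summable, rule summable_on_comparison_test)
  show "(\<lambda>k. (cmod (x k))\<^sup>2 + (cmod (y k))\<^sup>2) summable_on UNIV"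
    using assms unfolding square_summable_def by (rule summable_on_add)
  fix k
  have "2 * (cmod (x k) * cmod (y k)) \<le> (cmod (x k))\<^sup>2 + (cmod (y k))\<^sup>2"
    using zero_le_power2[of "cmod (x k) - cmod (y k)"] by (simp add: power2_diff)
  moreover have "0 \<le> cmod (x k) * cmod (y k)" by simp
  ultimately show "norm (x k * cnj (y k)) \<le> (cmod (x k))\<^sup>2 + (cmod (y k))\<^sup>2"
    unfolding norm_mult complex_mod_cnj by linarith
qed simp

typedef ell2 = "{x. square_summable x}"
  morphisms coeff Abs_ell2
  using square_summable_zero by blast

setup_lifting type_definition_ell2

lemma square_summable_coeff: "square_summable (coeff x)"
  using coeff by simp

lift_definition cinner :: "ell2 \<Rightarrow> ell2 \<Rightarrow> complex"
  is "\<lambda>x y. \<Sum>\<^sub>\<infinity>k. x k * cnj (y k)" .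

lift_definition cscale :: "complex \<Rightarrow> ell2 \<Rightarrow> ell2"
  is "\<lambda>c x k. c * x k"
  by (rule square_summable_bounded_mult[where C = "cmod c" for c]) (auto simp: norm_mult)

text \<open>The norm is the usual one, \<open>\<parallel>x\<parallel>\<^sup>2 = \<Sum>\<bar>x k\<bar>\<^sup>2\<close>; the real inner
  product demanded by the type class is the real part of the complex one.\<close>

instantiation ell2 :: real_inner
begin

lift_definition zero_ell2 :: ell2 is "\<lambda>_. 0"
  by (rule square_summable_zero)

lift_definition plus_ell2 :: "ell2 \<Rightarrow> ell2 \<Rightarrow> ell2" is "\<lambda>x y k. x k + y k"
  by (rule square_summable_add)

lift_definition uminus_ell2 :: "ell2 \<Rightarrow> ell2" is "\<lambda>x k. - x k"
  by (simp add: square_summable_def)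

definition minus_ell2 :: "ell2 \<Rightarrow> ell2 \<Rightarrow> ell2" where
  "minus_ell2 x y = x + (- y)"

definition scaleR_ell2 :: "real \<Rightarrow> ell2 \<Rightarrow> ell2" where
  "scaleR_ell2 r x = cscale (complex_of_real r) x"

definition inner_ell2 :: "ell2 \<Rightarrow> ell2 \<Rightarrow> real" where
  "inner_ell2 x y = Re (cinner x y)"

definition norm_ell2 :: "ell2 \<Rightarrow> real" where
  "norm_ell2 x = sqrt (\<Sum>\<^sub>\<infinity>k. (cmod (coeff x k))\<^sup>2)"

definition dist_ell2 :: "ell2 \<Rightarrow> ell2 \<Rightarrow> real" where
  "dist_ell2 x y = norm (x - y)"

definition sgn_ell2 :: "ell2 \<Rightarrow> ell2" where
  "sgn_ell2 x = inverse (norm x) *\<^sub>R x"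

definition [code del]:
  "(uniformity :: (ell2 \<times> ell2) filter) = (INF e\<in>{0 <..}. principal {(x, y). dist x y < e})"

definition open_ell2 :: "ell2 set \<Rightarrow> bool" where
  "open_ell2 U \<longleftrightarrow> (\<forall>x\<in>U. eventually (\<lambda>(x', y). x' = x \<longrightarrow> y \<in> U) uniformity)"

lemma cinner_self: "cinner x x = complex_of_real (\<Sum>\<^sub>\<infinity>k. (cmod (coeff x k))\<^sup>2)"
proof -
  have "cinner x x = (\<Sum>\<^sub>\<infinity>k. complex_of_real ((cmod (coeff x k))\<^sup>2))"
    by (simp only: cinner.rep_eq complex_norm_square)
  also have "\<dots> = complex_of_real (\<Sum>\<^sub>\<infinity>k. (cmod (coeff x k))\<^sup>2)"
    using square_summable_coeff[of x] unfolding square_summable_def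
    by (intro infsumI has_sum_of_real has_sum_infsum)
  finally show ?thesis .
qed

instance
proof
  fix x y z :: ell2 and r s :: real
  show "x + y + z = x + (y + z)" by transfer (simp add: add.assoc)
  show "x + y = y + x" by transfer (simp add: add.commute)
  show "0 + x = x" by transfer simp
  show "- x + x = 0" by transfer simp
  show "x - y = x + - y" by (rule minus_ell2_def)
  show "r *\<^sub>R (x + y) = r *\<^sub>R x + r *\<^sub>R y"
    unfolding scaleR_ell2_def by transfer (simp add: algebra_simps)
  show "(r + s) *\<^sub>R x = r *\<^sub>R x + s *\<^sub>R x"
    unfolding scaleR_ell2_def by transfer (simp add: algebra_simps)
  show "r *\<^sub>R s *\<^sub>R x = (r * s) *\<^sub>R x"
    unfolding scaleR_ell2_def by transfer (simp add: algebra_simps)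
  show "1 *\<^sub>R x = x" unfolding scaleR_ell2_def by transfer simp
  show "dist x y = norm (x - y)" by (rule dist_ell2_def)
  show "sgn x = inverse (norm x) *\<^sub>R x" by (rule sgn_ell2_def)
  show "(uniformity :: (ell2 \<times> ell2) filter) = (INF e\<in>{0 <..}. principal {(x, y). dist x y < e})"
    by (rule uniformity_ell2_def)
  show "open U \<longleftrightarrow> (\<forall>x\<in>U. eventually (\<lambda>(x', y). x' = x \<longrightarrow> y \<in> U) uniformity)"
    for U :: "ell2 set" by (rule open_ell2_def)
  show "inner x y = inner y x"
  proof -
    have "cinner x y = cnj (cinner y x)"
      by (simp add: cinner.rep_eq mult.commute flip: infsum_cnj)
    then show ?thesis by (simp add: inner_ell2_def)
  qed
  show "inner (x + y) z = inner x z + inner y z"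
    by (simp add: inner_ell2_def cinner.rep_eq plus_ell2.rep_eq ring_distribs infsum_add
        square_summable_prod square_summable_coeff)
  show "inner (r *\<^sub>R x) y = r * inner x y"
    by (simp add: inner_ell2_def scaleR_ell2_def cinner.rep_eq cscale.rep_eq mult.assoc
        infsum_cmult_right')
  show "0 \<le> inner x x"
    by (simp add: inner_ell2_def cinner_self infsum_nonneg)
  show "norm x = sqrt (inner x x)"
    by (simp add: inner_ell2_def cinner_self norm_ell2_def)
  show "inner x x = 0 \<longleftrightarrow> x = 0"
  proof
    assume "inner x x = 0"
    then have "(\<Sum>\<^sub>\<infinity>k. (cmod (coeff x k))\<^sup>2) \<le> 0"
      by (simp add: inner_ell2_def cinner_self)
    then have "(cmod (coeff x k))\<^sup>2 = 0" for k
      using square_summable_coeff[of x] unfolding square_summable_def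
      by (rule nonneg_infsum_le_0D) auto
    then have "coeff x k = 0" for k by simp
    then show "x = 0" by transfer auto
  next
    show "x = 0 \<Longrightarrow> inner x x = 0"
      by (simp add: inner_ell2_def cinner.rep_eq zero_ell2.rep_eq)
  qed
qed

end

lemma norm_ell2_le:
  assumes "0 \<le> C" and "\<And>k. cmod (coeff y k) \<le> C * cmod (coeff x k)"
  shows "norm y \<le> C * norm x"
proof -
  have "(\<Sum>\<^sub>\<infinity>k. (cmod (coeff y k))\<^sup>2) \<le> (\<Sum>\<^sub>\<infinity>k. C\<^sup>2 * (cmod (coeff x k))\<^sup>2)"
  proof (rule infsum_mono)
    show "(\<lambda>k. (cmod (coeff y k))\<^sup>2) summable_on UNIV"
      using square_summable_coeff[of y] by (simp add: square_summable_def)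
    show "(\<lambda>k. C\<^sup>2 * (cmod (coeff x k))\<^sup>2) summable_on UNIV"
      using square_summable_coeff[of x] unfolding square_summable_def
      by (rule summable_on_cmult_right)
    show "(cmod (coeff y k))\<^sup>2 \<le> C\<^sup>2 * (cmod (coeff x k))\<^sup>2" for k
      using power_mono[OF assms(2)[of k], of 2] by (simp add: power_mult_distrib)
  qed
  also have "\<dots> = C\<^sup>2 * (\<Sum>\<^sub>\<infinity>k. (cmod (coeff x k))\<^sup>2)"
    by (rule infsum_cmult_right')
  finally have "norm y \<le> sqrt (C\<^sup>2 * (\<Sum>\<^sub>\<infinity>k. (cmod (coeff x k))\<^sup>2))"
    unfolding norm_ell2_def by (rule real_sqrt_le_mono)
  then show ?thesis using assms(1) by (simp add: norm_ell2_def real_sqrt_mult)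
qed

lift_definition basis :: "int \<Rightarrow> ell2" is "\<lambda>k j. if j = k then 1 else 0"
proof -
  fix k :: int
  have "(\<lambda>j. (cmod (if j = k then 1 else 0))\<^sup>2) summable_on {k}" by simp
  then have "(\<lambda>j. (cmod (if j = k then 1 else 0))\<^sup>2) summable_on UNIV"
    by (rule summable_on_cong_neutral[THEN iffD1, rotated -1]) auto
  then show "square_summable (\<lambda>j. if j = k then 1 else 0)"
    by (simp add: square_summable_def)
qed

text \<open>The finite linear combinations of the basis vectors.\<close>

definition finite_vectors :: "ell2 set" where
  "finite_vectors = {x. finite {k. coeff x k \<noteq> 0}}"

section \<open>Operators\<close>

text \<open>Bounded operators are elements of \<^typ>\<open>ell2 \<Rightarrow>\<^sub>L ell2\<close>, with its operator norm. That
  type only enforces real linearity, so complex linearity is stated separately.\<close>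

definition complex_linear_op :: "(ell2 \<Rightarrow>\<^sub>L ell2) \<Rightarrow> bool" where
  "complex_linear_op T \<longleftrightarrow> (\<forall>c x. blinfun_apply T (cscale c x) = cscale c (blinfun_apply T x))"

lemma bounded_linear_cscale: "bounded_linear (cscale c)"
proof (rule bounded_linear_intro[where K = "cmod c"])
  show "cscale c (x + y) = cscale c x + cscale c y" for x y
    by transfer (simp add: algebra_simps)
  show "cscale c (t *\<^sub>R x) = t *\<^sub>R cscale c x" for t x
    unfolding scaleR_ell2_def by transfer (simp add: algebra_simps)
  show "norm (cscale c x) \<le> norm x * cmod c" for x
    using norm_ell2_le[of "cmod c" "cscale c x" x]
    by (simp add: cscale.rep_eq norm_mult mult.commute)
qed

definition scale_op :: "complex \<Rightarrow> (ell2 \<Rightarrow>\<^sub>L ell2) \<Rightarrow> (ell2 \<Rightarrow>\<^sub>L ell2)" where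
  "scale_op c T = Blinfun (\<lambda>x. cscale c (blinfun_apply T x))"

lemma scale_op_apply: "blinfun_apply (scale_op c T) x = cscale c (blinfun_apply T x)"
proof -
  have "bounded_linear (\<lambda>x. cscale c (blinfun_apply T x))"
    by (rule bounded_linear_compose[OF bounded_linear_cscale blinfun.bounded_linear_right])
  then show ?thesis by (simp add: scale_op_def bounded_linear_Blinfun_apply)
qed

definition is_adjoint :: "(ell2 \<Rightarrow>\<^sub>L ell2) \<Rightarrow> (ell2 \<Rightarrow>\<^sub>L ell2) \<Rightarrow> bool" where
  "is_adjoint T S \<longleftrightarrow>
     (\<forall>x y. cinner (blinfun_apply T x) y = cinner x (blinfun_apply S y))"

text \<open>Every bounded complex linear operator has exactly one adjoint, so closure under adjoints
  can be stated with the relation \<^const>\<open>is_adjoint\<close>.\<close>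

definition unital_cstar_algebra :: "(ell2 \<Rightarrow>\<^sub>L ell2) set \<Rightarrow> bool" where
  "unital_cstar_algebra B \<longleftrightarrow>
     (\<forall>T\<in>B. complex_linear_op T) \<and>
     id_blinfun \<in> B \<and>
     (\<forall>T\<in>B. \<forall>S\<in>B. T + S \<in> B) \<and>
     (\<forall>c. \<forall>T\<in>B. scale_op c T \<in> B) \<and>
     (\<forall>T\<in>B. \<forall>S\<in>B. T o\<^sub>L S \<in> B) \<and>
     (\<forall>T\<in>B. \<forall>S. is_adjoint T S \<longrightarrow> S \<in> B) \<and>
     closed B"

definition cstar_generated :: "(ell2 \<Rightarrow>\<^sub>L ell2) \<Rightarrow> (ell2 \<Rightarrow>\<^sub>L ell2) set" where
  "cstar_generated T = \<Inter>{B. unital_cstar_algebra B \<and> T \<in> B}"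

text \<open>\<open>bshift n\<close> is the integer power \<open>U\<^sup>n\<close> of the bilateral shift \<open>U = bshift 1\<close>;
  see \<open>bshift_add\<close>, \<open>bshift_0\<close> and \<open>bshift_basis\<close> below.\<close>

lift_definition bshift_vec :: "int \<Rightarrow> ell2 \<Rightarrow> ell2" is "\<lambda>n x k. x (k - n)"
  by (rule square_summable_shift)

lift_definition bshift :: "int \<Rightarrow> (ell2 \<Rightarrow>\<^sub>L ell2)" is bshift_vec
proof (rule bounded_linear_intro[where K = 1])
  fix n :: int
  show "bshift_vec n (x + y) = bshift_vec n x + bshift_vec n y" for x y
    by transfer simp
  show "bshift_vec n (r *\<^sub>R x) = r *\<^sub>R bshift_vec n x" for r x
    unfolding scaleR_ell2_def by transfer simp
  fix x
  have "bij_betw (\<lambda>k. k - n) UNIV (UNIV :: int set)"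
    by (rule bij_betwI[of _ _ _ "\<lambda>k. k + n"]) auto
  from infsum_reindex_bij_betw[OF this, of "\<lambda>k. (cmod (coeff x k))\<^sup>2"]
  show "norm (bshift_vec n x) \<le> norm x * 1"
    by (simp add: norm_ell2_def bshift_vec.rep_eq)
qed

lemma bshift_0: "bshift 0 = id_blinfun"
  by (rule blinfun_eqI, simp add: bshift.rep_eq, transfer, simp)

lemma bshift_add: "bshift m o\<^sub>L bshift n = bshift (m + n)"
  by (rule blinfun_eqI, simp add: bshift.rep_eq, transfer, simp add: algebra_simps)

lemma bshift_basis: "blinfun_apply (bshift n) (basis k) = basis (k + n)"
  by (simp add: bshift.rep_eq, transfer) (auto simp: fun_eq_iff)

text \<open>The possibly unbounded diagonal operator \<open>a(\<K>)\<close> on its natural domain, which contains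
  \<^const>\<open>finite_vectors\<close>; the value \<open>0\<close> outside the domain is a dummy. For bounded \<open>a\<close> the
  domain is everything and \<open>diag_op a\<close> is the bounded operator.\<close>

lift_definition diag :: "(int \<Rightarrow> complex) \<Rightarrow> ell2 \<Rightarrow> ell2"
  is "\<lambda>a x. if square_summable (\<lambda>k. a k * x k) then (\<lambda>k. a k * x k) else (\<lambda>_. 0)"
  by (simp add: square_summable_zero)

definition diag_op :: "(int \<Rightarrow> complex) \<Rightarrow> (ell2 \<Rightarrow>\<^sub>L ell2)" where
  "diag_op a = Blinfun (diag a)"

lemma coeff_diag_bounded:
  assumes "bounded (range a)"
  shows "coeff (diag a x) k = a k * coeff x k"
proof -
  obtain C where "\<And>k. cmod (a k) \<le> C"
    using assms by (auto simp: bounded_iff)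
  then have "cmod (a k * coeff x k) \<le> C * cmod (coeff x k)" for k
    by (simp add: norm_mult mult_right_mono)
  from square_summable_bounded_mult[OF square_summable_coeff this]
  show ?thesis by (simp add: diag.rep_eq)
qed

lemma coeff_diag_finite:
  assumes "x \<in> finite_vectors"
  shows "coeff (diag a x) k = a k * coeff x k"
proof -
  have "finite {k. coeff x k \<noteq> 0}" using assms by (simp add: finite_vectors_def)
  then have "(\<lambda>k. (cmod (a k * coeff x k))\<^sup>2) summable_on {k. coeff x k \<noteq> 0}" by simp
  then have "(\<lambda>k. (cmod (a k * coeff x k))\<^sup>2) summable_on UNIV"
    by (rule summable_on_cong_neutral[THEN iffD1, rotated -1]) auto
  then have "square_summable (\<lambda>k. a k * coeff x k)"
    by (simp add: square_summable_def)
  then show ?thesis by (simp add: diag.rep_eq)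
qed

lemma diag_op_apply:
  assumes "bounded (range a)"
  shows "blinfun_apply (diag_op a) x = diag a x"
proof -
  obtain C where C: "\<And>k. cmod (a k) \<le> C"
    using assms by (auto simp: bounded_iff)
  then have "0 \<le> C" using norm_ge_zero order_trans by blast
  have "bounded_linear (diag a)"
  proof (rule bounded_linear_intro[where K = C])
    show "diag a (x + y) = diag a x + diag a y" for x y
      by (rule coeff_inject[THEN iffD1], rule ext)
        (simp add: coeff_diag_bounded[OF assms] plus_ell2.rep_eq algebra_simps)
    show "diag a (r *\<^sub>R x) = r *\<^sub>R diag a x" for r x
      by (rule coeff_inject[THEN iffD1], rule ext)
        (simp add: coeff_diag_bounded[OF assms] scaleR_ell2_def cscale.rep_eq)
    show "norm (diag a x) \<le> norm x * C" for x
      using norm_ell2_le[of C "diag a x" x] C \<open>0 \<le> C\<close>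
      by (simp add: coeff_diag_bounded[OF assms] norm_mult mult_right_mono mult.commute)
  qed
  then show ?thesis by (simp add: diag_op_def bounded_linear_Blinfun_apply)
qed

lemma diag_basis: "diag a (basis k) = cscale (a k) (basis k)"
proof -
  have "{j. coeff (basis k) j \<noteq> 0} = {k}" by (auto simp: basis.rep_eq)
  then have "basis k \<in> finite_vectors" by (simp add: finite_vectors_def)
  then show ?thesis
    by (intro coeff_inject[THEN iffD1] ext)
      (simp add: coeff_diag_finite cscale.rep_eq basis.rep_eq)
qed

section \<open>The quantum annulus\<close>

definition U_r :: "real \<Rightarrow> (ell2 \<Rightarrow>\<^sub>L ell2)" where
  "U_r r = bshift 1 o\<^sub>L diag_op (\<lambda>k. if k < 0 then complex_of_real r else 1)"

lemma U_r_basis: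
  "blinfun_apply (U_r r) (basis k) =
     (if k < 0 then r *\<^sub>R basis (k + 1) else basis (k + 1))"
proof -
  have "bounded (range (\<lambda>k::int. if k < 0 then complex_of_real r else 1))"
    by (rule finite_imp_bounded, rule finite_subset[of _ "{complex_of_real r, 1}"]) auto
  moreover have "cscale 1 x = x" for x
    by (rule coeff_inject[THEN iffD1]) (simp add: cscale.rep_eq)
  ultimately show ?thesis
    by (simp add: U_r_def diag_op_apply diag_basis bshift_basis blinfun.scaleR_right
        flip: scaleR_ell2_def)
qed

definition quantum_annulus :: "real \<Rightarrow> (ell2 \<Rightarrow>\<^sub>L ell2) set" where
  "quantum_annulus r = cstar_generated (U_r r)"

definition c_Z :: "(int \<Rightarrow> complex) set" where
  "c_Z = {a. (\<exists>l. (a \<longlongrightarrow> l) at_top) \<and> (\<exists>l. (a \<longlongrightarrow> l) at_bot)}"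

definition eventually_constant :: "(int \<Rightarrow> complex) set" where
  "eventually_constant =
     {a. \<exists>k0. (\<exists>c. \<forall>k\<ge>k0. a k = c) \<and> (\<exists>c. \<forall>k\<le>-k0. a k = c)}"

definition c_inc :: "(int \<Rightarrow> complex) set" where
  "c_inc = {\<beta>. (\<lambda>k. \<beta> k - \<beta> (k - 1)) \<in> c_Z}"

definition eventually_linear :: "(int \<Rightarrow> complex) \<Rightarrow> bool" where
  "eventually_linear \<beta> \<longleftrightarrow> (\<lambda>k. \<beta> k - \<beta> (k - 1)) \<in> eventually_constant"

lemma bounded_eventually_constant:
  assumes "a \<in> eventually_constant"
  shows "bounded (range a)"
proof -
  obtain k0 c c' where c: "\<And>k. k \<ge> k0 \<Longrightarrow> a k = c" and c': "\<And>k. k \<le> -k0 \<Longrightarrow> a k = c'"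
    using assms by (auto simp: eventually_constant_def)
  have "a k \<in> {c, c'} \<union> a ` {-k0..k0}" for k
    using c[of k] c'[of k] by (cases "k \<ge> k0"; cases "k \<le> -k0") auto
  then have "range a \<subseteq> {c, c'} \<union> a ` {-k0..k0}" by blast
  then show ?thesis by (meson finite.intros finite_UnI finite_atLeastAtMost_int finite_imageI
        finite_imp_bounded finite_subset)
qed

definition poly_algebra :: "(ell2 \<Rightarrow>\<^sub>L ell2) set" where
  "poly_algebra =
     {(\<Sum>n\<in>F. bshift n o\<^sub>L diag_op (a n)) | F a.
        finite F \<and> (\<forall>n\<in>F. a n \<in> eventually_constant)}"

definition rho :: "real \<Rightarrow> (ell2 \<Rightarrow>\<^sub>L ell2) \<Rightarrow> (ell2 \<Rightarrow>\<^sub>L ell2)" where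
  "rho \<theta> T = diag_op (\<lambda>k. cis (\<theta> * real_of_int k)) o\<^sub>L T o\<^sub>L
             diag_op (\<lambda>k. cis (- (\<theta> * real_of_int k)))"

text \<open>A derivation with domain \<^const>\<open>poly_algebra\<close> is a total function of which only
  the values on \<^const>\<open>poly_algebra\<close> matter.\<close>

definition derivation :: "real \<Rightarrow> ((ell2 \<Rightarrow>\<^sub>L ell2) \<Rightarrow> (ell2 \<Rightarrow>\<^sub>L ell2)) \<Rightarrow> bool" where
  "derivation r d \<longleftrightarrow>
     d ` poly_algebra \<subseteq> quantum_annulus r \<and>
     (\<forall>a\<in>poly_algebra. \<forall>b\<in>poly_algebra. d (a + b) = d a + d b) \<and>
     (\<forall>c. \<forall>a\<in>poly_algebra. d (scale_op c a) = scale_op c (d a)) \<and>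
     (\<forall>a\<in>poly_algebra. \<forall>b\<in>poly_algebra. d (a o\<^sub>L b) = (a o\<^sub>L d b) + (d a o\<^sub>L b))"

definition covariant :: "((ell2 \<Rightarrow>\<^sub>L ell2) \<Rightarrow> (ell2 \<Rightarrow>\<^sub>L ell2)) \<Rightarrow> bool" where
  "covariant d \<longleftrightarrow>
     (\<forall>a\<in>poly_algebra. \<forall>\<theta>\<in>{0..<2 * pi}.
        d (rho \<theta> a) = scale_op (cis (- \<theta>)) (rho \<theta> (d a)))"

definition U_beta :: "(int \<Rightarrow> complex) \<Rightarrow> ell2 \<Rightarrow> ell2" where
  "U_beta \<beta> x = blinfun_apply (bshift 1) (diag \<beta> x)"

text \<open>\<open>is_commutator \<beta> a T\<close> says that the commutator \<open>[U\<beta>(\<K>), a]\<close>, formed on the finite linear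
  combinations of basis vectors, is bounded there and that \<open>T\<close> is its continuous extension. It is
  meant for \<open>a\<close> in \<^const>\<open>poly_algebra\<close>, which maps \<^const>\<open>finite_vectors\<close> into itself.\<close>

definition is_commutator ::
    "(int \<Rightarrow> complex) \<Rightarrow> (ell2 \<Rightarrow>\<^sub>L ell2) \<Rightarrow> (ell2 \<Rightarrow>\<^sub>L ell2) \<Rightarrow> bool" where
  "is_commutator \<beta> a T \<longleftrightarrow>
     (\<forall>x\<in>finite_vectors.
        blinfun_apply T x = U_beta \<beta> (blinfun_apply a x) - blinfun_apply a (U_beta \<beta> x))"

end

theory Submission
  imports Defs
begin

text \<open>
  Covariance forces \<open>d (U\<^sup>n a(\<K>))\<close> to have matrix entries only on the diagonal number \<open>n + 1\<close>. With
  \<open>P\<^sub>k\<close> the projection onto \<open>E\<^sub>k\<close>, define \<open>\<beta>\<close> by \<open>d (P\<^sub>k) E\<^sub>k = \<beta> k E\<^sub>k\<^sub>+\<^sub>1\<close>. Applying \<open>d\<close> to the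
  intertwining relation \<open>T P\<^sub>k = P\<^sub>k\<^sub>+\<^sub>n T\<close> for \<open>T = U\<^sup>n a(\<K>)\<close> and evaluating at \<open>E\<^sub>k\<close> then gives
  \<open>d T = [U \<beta>(\<K>), T]\<close>. The increments of \<open>\<beta>\<close> are the entries of \<open>d U\<close>; they have limits because
  every element of the quantum annulus is a norm limit of finite sums of operators \<open>U\<^sup>n a(\<K>)\<close> with
  \<open>a \<in> c(\<int>)\<close>, so that each of its diagonals is a uniform limit of elements of \<open>c(\<int>)\<close>.
\<close>

section \<open>Matrix entries\<close>

abbreviation entry :: "(ell2 \<Rightarrow>\<^sub>L ell2) \<Rightarrow> int \<Rightarrow> int \<Rightarrow> complex" where
  "entry T j k \<equiv> coeff (blinfun_apply T (basis k)) j"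

lemma ell2_eqI: "(\<And>k. coeff x k = coeff y k) \<Longrightarrow> x = y"
  by (rule coeff_inject[THEN iffD1], rule ext)

lemma coeff_minus: "coeff (x - y) k = coeff x k - coeff y k"
  unfolding minus_ell2_def plus_ell2.rep_eq uminus_ell2.rep_eq by simp

lemma coeff_sum: "coeff (\<Sum>i\<in>I. f i) k = (\<Sum>i\<in>I. coeff (f i) k)"
  by (induction I rule: infinite_finite_induct) (simp_all add: zero_ell2.rep_eq plus_ell2.rep_eq)

lemma coeff_bshift: "coeff (blinfun_apply (bshift n) x) k = coeff x (k - n)"
  by (simp add: bshift.rep_eq bshift_vec.rep_eq)

lemma coeff_monomial:
  assumes "bounded (range a)"
  shows "coeff (blinfun_apply (bshift n o\<^sub>L diag_op a) x) k = a (k - n) * coeff x (k - n)"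
  by (simp add: coeff_bshift diag_op_apply coeff_diag_bounded assms)

lemma norm_basis: "norm (basis k) = 1"
proof -
  have "(\<Sum>\<^sub>\<infinity>j. (cmod (coeff (basis k) j))\<^sup>2) = (\<Sum>\<^sub>\<infinity>j\<in>{k}. (cmod (coeff (basis k) j))\<^sup>2)"
    by (rule infsum_cong_neutral) (auto simp: basis.rep_eq)
  then show ?thesis by (simp add: norm_ell2_def basis.rep_eq)
qed

text \<open>The vector x_k E_k has norm |x_k| and is dominated coordinatewise by x, so
  \<open>norm_ell2_le\<close> compares the norms.\<close>

lemma cmod_coeff_le: "cmod (coeff x k) \<le> norm x"
proof -
  have "norm (cscale (coeff x k) (basis k)) = cmod (coeff x k)"
  proof (rule antisym)
    show "norm (cscale (coeff x k) (basis k)) \<le> cmod (coeff x k)"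
      using norm_ell2_le[of "cmod (coeff x k)" "cscale (coeff x k) (basis k)" "basis k"]
      by (simp add: cscale.rep_eq norm_mult norm_basis)
    have "norm (basis k) * cmod (coeff x k) \<le> norm (cscale (coeff x k) (basis k))"
    proof (cases "coeff x k = 0")
      case False
      then show ?thesis
        using norm_ell2_le[of "1 / cmod (coeff x k)" "basis k" "cscale (coeff x k) (basis k)"]
        by (simp add: cscale.rep_eq norm_mult field_simps)
    qed simp
    then show "cmod (coeff x k) \<le> norm (cscale (coeff x k) (basis k))"
      by (simp add: norm_basis)
  qed
  moreover have "norm (cscale (coeff x k) (basis k)) \<le> 1 * norm x"
    by (rule norm_ell2_le) (auto simp: cscale.rep_eq basis.rep_eq)
  ultimately show ?thesis by simp
qed

lemma cmod_entry_le: "cmod (entry T j k) \<le> norm T"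
  using order_trans[OF cmod_coeff_le norm_blinfun[of T "basis k"]] by (simp add: norm_basis)

lemma basis_finite_vectors: "basis k \<in> finite_vectors"
  by (simp add: finite_vectors_def basis.rep_eq)

lemma finite_vectors_expand:
  assumes "x \<in> finite_vectors"
  shows "x = (\<Sum>k\<in>{k. coeff x k \<noteq> 0}. cscale (coeff x k) (basis k))"
proof (rule ell2_eqI)
  fix j
  have "(\<Sum>k\<in>{k. coeff x k \<noteq> 0}. coeff (cscale (coeff x k) (basis k)) j) =
      (\<Sum>k\<in>{k. coeff x k \<noteq> 0}. if j = k then coeff x k else 0)"
    by (rule sum.cong) (simp_all add: cscale.rep_eq basis.rep_eq)
  also have "\<dots> = coeff x j"
    using assms by (simp add: finite_vectors_def)
  finally show "coeff x j = coeff (\<Sum>k\<in>{k. coeff x k \<noteq> 0}. cscale (coeff x k) (basis k)) j"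
    by (simp add: coeff_sum)
qed

text \<open>Expand x in basis vectors: in row j only column j - n survives. Complex linearity is
  assumed separately because the type of bounded operators gives real linearity only.\<close>

lemma coeff_apply_single_diagonal:
  assumes T: "complex_linear_op T" and x: "x \<in> finite_vectors"
    and zero: "\<And>k. j \<noteq> k + n \<Longrightarrow> entry T j k = 0"
  shows "coeff (blinfun_apply T x) j = entry T j (j - n) * coeff x (j - n)"
proof -
  let ?S = "{k. coeff x k \<noteq> 0}"
  have fin: "finite ?S" using x by (simp add: finite_vectors_def)
  have "coeff (blinfun_apply T x) j = (\<Sum>k\<in>?S. coeff x k * entry T j k)"
    using T by (subst finite_vectors_expand[OF x])
      (simp add: blinfun.sum_right coeff_sum complex_linear_op_def cscale.rep_eq)
  also have "\<dots> = (\<Sum>k\<in>?S. if k = j - n then coeff x k * entry T j k else 0)"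
    by (rule sum.cong) (use zero in auto)
  also have "\<dots> = entry T j (j - n) * coeff x (j - n)"
    using fin by (simp add: sum.delta)
  finally show ?thesis .
qed

section \<open>Elements of the quantum annulus as limits of band operators\<close>

lemma bounded_c_Z:
  assumes "a \<in> c_Z"
  shows "bounded (range a)"
proof -
  obtain l l' where l: "(a \<longlongrightarrow> l) at_top" and l': "(a \<longlongrightarrow> l') at_bot"
    using assms by (auto simp: c_Z_def)
  obtain K where K: "\<And>k. k \<ge> K \<Longrightarrow> dist (a k) l < 1"
    using tendstoD[OF l zero_less_one] by (auto simp: eventually_at_top_linorder)
  obtain K' where K': "\<And>k. k \<le> K' \<Longrightarrow> dist (a k) l' < 1"
    using tendstoD[OF l' zero_less_one] by (auto simp: eventually_at_bot_linorder)
  have "range a \<subseteq> ball l 1 \<union> ball l' 1 \<union> a ` {K'..K}"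
  proof
    fix z assume "z \<in> range a"
    then obtain k where "z = a k" by auto
    then show "z \<in> ball l 1 \<union> ball l' 1 \<union> a ` {K'..K}"
      using K[of k] K'[of k] by (cases "k \<ge> K"; cases "k \<le> K'") (auto simp: dist_commute)
  qed
  moreover have "bounded (ball l 1 \<union> ball l' 1 \<union> a ` {K'..K})"
    by (simp add: finite_imp_bounded)
  ultimately show ?thesis using bounded_subset by blast
qed

lemma c_Z_const: "(\<lambda>_. c) \<in> c_Z"
  by (auto simp: c_Z_def)

lemma c_Z_add: "a \<in> c_Z \<Longrightarrow> b \<in> c_Z \<Longrightarrow> (\<lambda>k. a k + b k) \<in> c_Z"
  by (auto simp: c_Z_def intro: tendsto_add)

lemma c_Z_mult: "a \<in> c_Z \<Longrightarrow> b \<in> c_Z \<Longrightarrow> (\<lambda>k. a k * b k) \<in> c_Z"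
  by (auto simp: c_Z_def intro: tendsto_mult)

lemma c_Z_cnj: "a \<in> c_Z \<Longrightarrow> (\<lambda>k. cnj (a k)) \<in> c_Z"
  by (auto simp: c_Z_def intro: tendsto_cnj)

lemma c_Z_shift:
  assumes "a \<in> c_Z"
  shows "(\<lambda>k. a (k + n)) \<in> c_Z"
proof -
  have "filterlim (\<lambda>k. k + n) at_top (at_top :: int filter)"
    unfolding filterlim_at_top eventually_at_top_linorder
    by (metis diff_add_cancel add_le_cancel_right)
  moreover have "filterlim (\<lambda>k. k + n) at_bot (at_bot :: int filter)"
    unfolding filterlim_at_bot eventually_at_bot_linorder
    by (metis diff_add_cancel add_le_cancel_right)
  ultimately show ?thesis
    using assms unfolding c_Z_def by (auto intro: filterlim_compose)
qed

text \<open>The limit of the approximant may vary with e, so no candidate limit for f is at hand;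
  the image filter is shown to be Cauchy and completeness supplies the limit.\<close>

lemma uniform_limit_convergent:
  fixes f :: "'a \<Rightarrow> 'b::complete_space"
  assumes "F \<noteq> bot"
    and approx: "\<And>e. e > 0 \<Longrightarrow> \<exists>g l. (g \<longlongrightarrow> l) F \<and> (\<forall>x. dist (f x) (g x) < e)"
  shows "\<exists>l. (f \<longlongrightarrow> l) F"
proof -
  have "cauchy_filter (filtermap f F)"
    unfolding cauchy_filter_metric_filtermap
  proof (intro allI impI)
    fix e :: real assume "e > 0"
    \<comment> \<open>The path from f x to f y runs through g x, l and g y: four legs, each shorter
      than e / 4.\<close>
    then obtain g l where g: "(g \<longlongrightarrow> l) F" and fg: "\<And>x. dist (f x) (g x) < e / 4"
      using approx[of "e / 4"] by auto
    have "eventually (\<lambda>x. dist (g x) l < e / 4) F"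
      using tendstoD[OF g, of "e / 4"] \<open>e > 0\<close> by simp
    moreover have "dist (f x) (f y) < e" if "dist (g x) l < e / 4" "dist (g y) l < e / 4" for x y
      using that fg[of x] fg[of y] dist_triangle[of "f x" "f y" "g x"]
        dist_triangle[of "g x" "f y" l] dist_triangle[of l "f y" "g y"]
      by (simp add: dist_commute)
    ultimately show "\<exists>P. eventually P F \<and> (\<forall>x y. P x \<and> P y \<longrightarrow> dist (f x) (f y) < e)" by blast
  qed
  then have "\<exists>l. filtermap f F \<le> nhds l"
    using cauchy_filter_complete_converges[OF _ complete_UNIV, of "filtermap f F"] assms(1)
    by (simp add: filtermap_bot_iff)
  then show ?thesis by (simp add: filterlim_def)
qed

lemma c_Z_uniform_limit:
  assumes "\<And>e. e > 0 \<Longrightarrow> \<exists>a\<in>c_Z. \<forall>k. dist (f k) (a k) < e"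
  shows "f \<in> c_Z"
proof -
  have "\<exists>l. (f \<longlongrightarrow> l) at_top" "\<exists>l. (f \<longlongrightarrow> l) at_bot"
    by (rule uniform_limit_convergent; use assms in \<open>force simp: c_Z_def\<close>)+
  then show ?thesis by (simp add: c_Z_def)
qed

section \<open>The algebra of band operators\<close>

text \<open>These are the finite nonempty sums of operators U^n a(K) with a in c(Z). Generating them
  inductively replaces bookkeeping with index sets by induction on sums.\<close>

inductive_set band :: "(ell2 \<Rightarrow>\<^sub>L ell2) set" where
  monomial: "a \<in> c_Z \<Longrightarrow> bshift n o\<^sub>L diag_op a \<in> band"
| add: "T \<in> band \<Longrightarrow> S \<in> band \<Longrightarrow> T + S \<in> band"

lemma band_scalar: "scale_op c id_blinfun \<in> band"
proof -
  have "scale_op c id_blinfun = bshift 0 o\<^sub>L diag_op (\<lambda>_. c)"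
    by (intro blinfun_eqI ell2_eqI)
      (simp add: coeff_monomial bounded_c_Z c_Z_const scale_op_apply cscale.rep_eq del: blinfun_apply_blinfun_compose)
  then show ?thesis by (simp add: band.monomial c_Z_const)
qed

text \<open>This is the commutation relation a(K) U^n = U^n a(K + n).\<close>

lemma monomial_mult:
  assumes "a \<in> c_Z" "b \<in> c_Z"
  shows "(bshift m o\<^sub>L diag_op a) o\<^sub>L (bshift n o\<^sub>L diag_op b) =
    bshift (m + n) o\<^sub>L diag_op (\<lambda>k. a (k + n) * b k)"
proof (intro blinfun_eqI ell2_eqI)
  fix x k
  have "bounded (range (\<lambda>k. a (k + n) * b k))"
    by (intro bounded_c_Z c_Z_mult c_Z_shift assms)
  from coeff_monomial[OF this, of "m + n" x k]
  show "coeff (blinfun_apply ((bshift m o\<^sub>L diag_op a) o\<^sub>L (bshift n o\<^sub>L diag_op b)) x) k =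
    coeff (blinfun_apply (bshift (m + n) o\<^sub>L diag_op (\<lambda>k. a (k + n) * b k)) x) k"
    using coeff_monomial[OF bounded_c_Z[OF assms(1)]] coeff_monomial[OF bounded_c_Z[OF assms(2)]]
    by (simp add: algebra_simps)
qed

lemma band_mult:
  assumes "T \<in> band" "S \<in> band"
  shows "T o\<^sub>L S \<in> band"
  using assms(1)
proof induction
  case (monomial a m)
  show ?case using assms(2)
  proof induction
    case (monomial b n)
    then show ?case
      using \<open>a \<in> c_Z\<close> by (simp add: monomial_mult band.monomial c_Z_mult c_Z_shift)
  next
    case (add S S')
    then show ?case by (simp add: bounded_bilinear.add_right[OF bounded_bilinear_blinfun_compose] band.add)
  qed
next
  case (add T T')
  then show ?case by (simp add: bounded_bilinear.add_left[OF bounded_bilinear_blinfun_compose] band.add)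
qed

text \<open>With b the conjugate of a, the adjoint of U^n a(K) is b(K) U^(-n) = U^(-n) b(K - n). On
  inner products this is the substitution j = k + n.\<close>

lemma is_adjoint_monomial:
  assumes "a \<in> c_Z"
  shows "is_adjoint (bshift n o\<^sub>L diag_op a) (bshift (- n) o\<^sub>L diag_op (\<lambda>k. cnj (a (k - n))))"
  unfolding is_adjoint_def
proof (intro allI)
  fix x y
  have a': "(\<lambda>k. cnj (a (k - n))) \<in> c_Z"
    using c_Z_cnj[OF c_Z_shift[OF assms, of "- n"]] by simp
  have bij: "bij_betw (\<lambda>k. k + n) UNIV (UNIV :: int set)"
    by (rule bij_betwI[of _ _ _ "\<lambda>k. k - n"]) auto
  have "cinner (blinfun_apply (bshift n o\<^sub>L diag_op a) x) y =
      (\<Sum>\<^sub>\<infinity>j. a (j - n) * coeff x (j - n) * cnj (coeff y j))"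
    unfolding cinner.rep_eq coeff_monomial[OF bounded_c_Z[OF assms]] ..
  also have "\<dots> = (\<Sum>\<^sub>\<infinity>k. a k * coeff x k * cnj (coeff y (k + n)))"
    by (subst infsum_reindex_bij_betw[OF bij, symmetric]) simp
  also have "\<dots> = cinner x (blinfun_apply (bshift (- n) o\<^sub>L diag_op (\<lambda>k. cnj (a (k - n)))) y)"
    unfolding cinner.rep_eq coeff_monomial[OF bounded_c_Z[OF a']] by (simp add: ac_simps)
  finally show "cinner (blinfun_apply (bshift n o\<^sub>L diag_op a) x) y =
    cinner x (blinfun_apply (bshift (- n) o\<^sub>L diag_op (\<lambda>k. cnj (a (k - n)))) y)" .
qed

lemma cinner_add_left: "cinner (x + y) z = cinner x z + cinner y z"
  by (simp add: cinner.rep_eq plus_ell2.rep_eq ring_distribs infsum_add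
      square_summable_prod square_summable_coeff)

lemma cinner_add_right: "cinner x (y + z) = cinner x y + cinner x z"
  by (simp add: cinner.rep_eq plus_ell2.rep_eq ring_distribs infsum_add
      square_summable_prod square_summable_coeff)

lemma band_adjoint: "T \<in> band \<Longrightarrow> \<exists>S\<in>band. is_adjoint T S"
proof (induction rule: band.induct)
  case (monomial a n)
  have "(\<lambda>k. cnj (a (k - n))) \<in> c_Z"
    using c_Z_cnj[OF c_Z_shift[OF monomial, of "- n"]] by simp
  then show ?case using is_adjoint_monomial[OF monomial] band.monomial by blast
next
  case (add T T')
  then obtain S S' where "S \<in> band" "S' \<in> band" "is_adjoint T S" "is_adjoint T' S'" by blast
  then have "is_adjoint (T + T') (S + S')"
    by (simp add: is_adjoint_def blinfun.add_left cinner_add_left cinner_add_right)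
  then show ?case using \<open>S \<in> band\<close> \<open>S' \<in> band\<close> band.add by blast
qed

section \<open>The norm closure of the band operators is a C*-algebra\<close>

text \<open>For z = (S - S')y one has <z, z> = <(T - T')z, y>; Cauchy-Schwarz and division by the
  norm of z give the bound. It carries approximations over to adjoints, which are given only as a
  relation.\<close>

lemma norm_adjoint_diff_le:
  assumes "is_adjoint T S" "is_adjoint T' S'"
  shows "norm (S - S') \<le> norm (T - T')"
proof (rule norm_blinfun_bound)
  fix y
  define z where "z = blinfun_apply (S - S') y"
  have "inner (blinfun_apply T x) y = inner x (blinfun_apply S y)"
    "inner (blinfun_apply T' x) y = inner x (blinfun_apply S' y)" for x
    using assms by (simp_all add: is_adjoint_def inner_ell2_def)
  then have "inner z z = inner (blinfun_apply (T - T') z) y"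
    by (simp add: z_def[symmetric] blinfun.diff_left inner_diff_left)
      (simp add: z_def blinfun.diff_left inner_diff_right)
  also have "\<dots> \<le> norm (blinfun_apply (T - T') z) * norm y"
    by (rule norm_cauchy_schwarz)
  also have "\<dots> \<le> norm (T - T') * norm z * norm y"
    by (intro mult_right_mono norm_blinfun) simp
  finally have "norm z * norm z \<le> (norm (T - T') * norm y) * norm z"
    by (simp add: power2_norm_eq_inner[symmetric] power2_eq_square ac_simps)
  then show "norm (blinfun_apply (S - S') y) \<le> norm (T - T') * norm y"
    unfolding z_def[symmetric] by (cases "norm z = 0") (auto simp: mult_le_cancel_right)
qed simp

text \<open>Complex linearity is a family of equations between continuous functions of T, so it
  survives norm limits.\<close>

lemma closed_complex_linear: "closed {T. complex_linear_op T}"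
proof -
  have cont: "continuous_on UNIV (\<lambda>T. blinfun_apply T x)" for x :: ell2
    by (intro linear_continuous_on blinfun.bounded_linear_left)
  show ?thesis
    unfolding complex_linear_op_def
    by (intro closed_Collect_all closed_Collect_eq cont
        bounded_linear.continuous_on[OF bounded_linear_cscale cont])
qed

lemma complex_linear_band: "T \<in> band \<Longrightarrow> complex_linear_op T"
proof (induction rule: band.induct)
  case (monomial a n)
  show ?case unfolding complex_linear_op_def
    by (intro allI ell2_eqI)
      (simp only: coeff_monomial[OF bounded_c_Z[OF monomial]] cscale.rep_eq ac_simps)
next
  case (add T S)
  then show ?case
    unfolding complex_linear_op_def
    by (simp add: blinfun.add_left linear_add[OF bounded_linear.linear[OF bounded_linear_cscale]])
qed

lemma complex_linear_closure_band: "T \<in> closure band \<Longrightarrow> complex_linear_op T"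
  using closure_minimal[of band "{T. complex_linear_op T}"] closed_complex_linear
    complex_linear_band by blast

lemma unital_cstar_algebra_closure_band: "unital_cstar_algebra (closure band)"
proof -
  have add: "T + S \<in> closure band" and mult: "T o\<^sub>L S \<in> closure band"
    if "T \<in> closure band" "S \<in> closure band" for T S
  proof -
    obtain f g where "\<And>n. f n \<in> band" "\<And>n. g n \<in> band" "f \<longlonglongrightarrow> T" "g \<longlonglongrightarrow> S"
      using \<open>T \<in> closure band\<close> \<open>S \<in> closure band\<close> by (auto simp: closure_sequential)
    then have "(\<lambda>n. f n + g n) \<longlonglongrightarrow> T + S" "(\<lambda>n. f n o\<^sub>L g n) \<longlonglongrightarrow> (T o\<^sub>L S)"
      "\<And>n. f n + g n \<in> band" "\<And>n. f n o\<^sub>L g n \<in> band"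
      by (auto intro: tendsto_add bounded_bilinear.tendsto[OF bounded_bilinear_blinfun_compose] band.add band_mult)
    then show "T + S \<in> closure band" "T o\<^sub>L S \<in> closure band"
      unfolding closure_sequential by meson+
  qed
  have scalar: "scale_op c id_blinfun \<in> closure band" for c
    using band_scalar closure_subset by blast
  have one: "id_blinfun \<in> closure band"
  proof -
    have "scale_op 1 id_blinfun = id_blinfun"
      by (intro blinfun_eqI ell2_eqI) (simp add: scale_op_apply cscale.rep_eq)
    then show ?thesis using scalar[of 1] by simp
  qed
  \<comment> \<open>Scaling is multiplication by a scalar operator, so closure under products covers
    it.\<close>
  have scale: "scale_op c T \<in> closure band" if "T \<in> closure band" for c T
  proof -
    have "scale_op c T = scale_op c id_blinfun o\<^sub>L T"
      by (intro blinfun_eqI) (simp add: scale_op_apply)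
    then show ?thesis using mult[OF scalar[of c] that] by simp
  qed
  have adjoint: "S \<in> closure band" if T: "T \<in> closure band" and S: "is_adjoint T S" for T S
    unfolding closure_approachable
  proof (intro allI impI)
    fix e :: real assume "e > 0"
    then obtain T' where T': "T' \<in> band" "dist T' T < e"
      using T unfolding closure_approachable by blast
    then obtain S' where "S' \<in> band" "is_adjoint T' S'" using band_adjoint by blast
    \<comment> \<open>Passing to adjoints does not increase distances, so the same e serves for
      S.\<close>
    then have "dist S' S < e"
      using norm_adjoint_diff_le[OF _ S, of T' S'] T' by (simp add: dist_norm)
    then show "\<exists>S'\<in>band. dist S' S < e" using \<open>S' \<in> band\<close> by blast
  qed
  show ?thesis
    unfolding unital_cstar_algebra_def
    by (intro conjI ballI allI impI complex_linear_closure_band one add mult scale closed_closure)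
      (assumption | rule adjoint, assumption+)+
qed

text \<open>The annulus is the smallest unital C*-algebra containing \<open>U_r r\<close>, and
  \<open>U_r r\<close> is itself a monomial: its weight has limit 1 at plus infinity and r at minus
  infinity.\<close>

lemma quantum_annulus_subset: "quantum_annulus r \<subseteq> closure band"
proof -
  have "(\<lambda>k. if k < 0 then complex_of_real r else 1) \<in> c_Z"
  proof -
    have "eventually (\<lambda>k::int. (if k < 0 then complex_of_real r else 1) = 1) at_top"
      unfolding eventually_at_top_linorder by (rule exI[of _ 0]) auto
    moreover have "eventually (\<lambda>k::int. (if k < 0 then complex_of_real r else 1) = complex_of_real r) at_bot"
      unfolding eventually_at_bot_linorder by (rule exI[of _ "-1"]) auto
    ultimately show ?thesis
      unfolding c_Z_def by (blast intro: tendsto_eventually)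
  qed
  then have "U_r r \<in> closure band"
    using band.monomial closure_subset unfolding U_r_def by blast
  then show ?thesis
    using unital_cstar_algebra_closure_band unfolding quantum_annulus_def cstar_generated_def by blast
qed

lemma complex_linear_quantum_annulus:
  "T \<in> quantum_annulus r \<Longrightarrow> complex_linear_op T"
  by (rule complex_linear_closure_band[OF subsetD[OF quantum_annulus_subset]])

section \<open>Diagonals of elements of the annulus\<close>

lemma entry_monomial:
  assumes "bounded (range a)"
  shows "entry (bshift n o\<^sub>L diag_op a) j k = (if j = k + n then a k else 0)"
  unfolding coeff_monomial[OF assms] by (auto simp: basis.rep_eq)

lemma band_diagonal: "T \<in> band \<Longrightarrow> (\<lambda>k. entry T (k + n) k) \<in> c_Z"
proof (induction rule: band.induct)
  case (monomial a m)
  then show ?case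
    unfolding entry_monomial[OF bounded_c_Z[OF monomial]] by (cases "n = m") (simp_all add: c_Z_const)
next
  case (add T S)
  then show ?case by (simp add: blinfun.add_left plus_ell2.rep_eq c_Z_add)
qed

text \<open>Taking the n-th diagonal is contractive from the operator norm to the supremum norm, by
  \<open>cmod_entry_le\<close>. A norm approximation by band operators thus becomes a uniform
  approximation by functions in c(Z).\<close>

lemma quantum_annulus_diagonal:
  assumes "T \<in> quantum_annulus r"
  shows "(\<lambda>k. entry T (k + n) k) \<in> c_Z"
proof (rule c_Z_uniform_limit)
  fix e :: real assume "e > 0"
  moreover have "T \<in> closure band" using assms quantum_annulus_subset by blast
  ultimately obtain S where S: "S \<in> band" "dist S T < e"
    unfolding closure_approachable by blast
  have "dist (entry T (k + n) k) (entry S (k + n) k) < e" for k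
    using cmod_entry_le[of "S - T" k "k + n"] S(2)
    by (simp add: dist_norm blinfun.diff_left coeff_minus norm_minus_commute)
  then show "\<exists>a\<in>c_Z. \<forall>k. dist (entry T (k + n) k) (a k) < e"
    by (intro bexI[OF _ band_diagonal[OF S(1), of n]]) blast
qed

section \<open>Covariant derivations\<close>

lemma eventually_constantI:
  assumes "\<And>k. k \<ge> k0 \<Longrightarrow> a k = c" "\<And>k. k \<le> -k0 \<Longrightarrow> a k = c'"
  shows "a \<in> eventually_constant"
  using assms unfolding eventually_constant_def by blast

text \<open>This puts the projection onto E_k into the domain of the derivation.\<close>

lemma delta_eventually_constant: "(\<lambda>j. if j = k then 1 else 0) \<in> eventually_constant"
  by (rule eventually_constantI[of "\<bar>k\<bar> + 1" _ 0 0]) auto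

lemma poly_algebra_monomial:
  "a \<in> eventually_constant \<Longrightarrow> bshift n o\<^sub>L diag_op a \<in> poly_algebra"
  unfolding poly_algebra_def by (rule CollectI, intro exI[of _ "{n}"] exI[of _ "\<lambda>_. a"]) simp

section \<open>Commutators with U \<beta>(K) on finite vectors\<close>

text \<open>Finite support guarantees that \<open>diag\<close> multiplies coordinatewise; outside
  the natural domain of \<beta>(K) it takes the dummy value 0.\<close>

lemma coeff_U_beta:
  "x \<in> finite_vectors \<Longrightarrow> coeff (U_beta \<beta> x) j = \<beta> (j - 1) * coeff x (j - 1)"
  by (simp add: U_beta_def coeff_bshift coeff_diag_finite)

lemma finite_vectors_shift_mult:
  assumes "x \<in> finite_vectors" and "\<And>j. coeff y j = b j * coeff x (j - n)"
  shows "y \<in> finite_vectors"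
proof -
  have "{j. coeff y j \<noteq> 0} \<subseteq> (\<lambda>k. k + n) ` {k. coeff x k \<noteq> 0}"
    using assms(2) by (auto intro!: rev_image_eqI[of "_ - n"])
  then show ?thesis
    using assms(1) unfolding finite_vectors_def by (auto intro: finite_subset)
qed

lemma finite_vectors_add:
  assumes "x \<in> finite_vectors" "y \<in> finite_vectors"
  shows "x + y \<in> finite_vectors"
  using assms unfolding finite_vectors_def mem_Collect_eq plus_ell2.rep_eq
  by (rule finite_subset[OF _ finite_UnI, rotated]) auto

lemma finite_vectors_monomial:
  assumes "bounded (range a)" "x \<in> finite_vectors"
  shows "blinfun_apply (bshift n o\<^sub>L diag_op a) x \<in> finite_vectors"
  by (rule finite_vectors_shift_mult[OF assms(2)], rule coeff_monomial[OF assms(1)])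

text \<open>Needed so that \<open>U_beta\<close> is again applied to a finite vector in the first
  term of the commutator.\<close>

lemma poly_algebra_finite_vectors:
  assumes "a \<in> poly_algebra" "x \<in> finite_vectors"
  shows "blinfun_apply a x \<in> finite_vectors"
proof -
  obtain F b where F: "finite F" "\<forall>n\<in>F. b n \<in> eventually_constant"
    and a: "a = (\<Sum>n\<in>F. bshift n o\<^sub>L diag_op (b n))"
    using assms(1) unfolding poly_algebra_def by blast
  have "blinfun_apply (\<Sum>n\<in>F. bshift n o\<^sub>L diag_op (b n)) x \<in> finite_vectors"
    using F
  proof (induction F)
    case empty
    then show ?case by (simp add: finite_vectors_def zero_ell2.rep_eq)
  next
    case (insert n F)
    then show ?case
      using finite_vectors_monomial[OF bounded_eventually_constant assms(2), of "b n" n]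
      by (simp add: blinfun.add_left finite_vectors_add)
  qed
  then show ?thesis using a by simp
qed

lemma is_commutator_add:
  assumes "is_commutator \<beta> a T" "is_commutator \<beta> b S" "a \<in> poly_algebra" "b \<in> poly_algebra"
  shows "is_commutator \<beta> (a + b) (T + S)"
  unfolding is_commutator_def
proof
  fix x assume x: "x \<in> finite_vectors"
  have "U_beta \<beta> (blinfun_apply a x + blinfun_apply b x) =
      U_beta \<beta> (blinfun_apply a x) + U_beta \<beta> (blinfun_apply b x)"
    using poly_algebra_finite_vectors[OF assms(3) x] poly_algebra_finite_vectors[OF assms(4) x]
    by (intro ell2_eqI)
      (simp add: coeff_U_beta finite_vectors_add plus_ell2.rep_eq algebra_simps)
  then show "blinfun_apply (T + S) x =
      U_beta \<beta> (blinfun_apply (a + b) x) - blinfun_apply (a + b) (U_beta \<beta> x)"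
    using assms(1,2) x unfolding is_commutator_def by (simp add: blinfun.add_left)
qed

text \<open>Applied to E_k, the product U \<beta>(K) U^n a(K) gives a(k) \<beta>(k+n) E_(k+n+1), and
  the reverse product gives \<beta>(k) a(k+1) E_(k+n+1).\<close>

lemma is_commutator_monomial_entry:
  assumes a: "bounded (range a)" and "is_commutator \<beta> (bshift n o\<^sub>L diag_op a) T"
  shows "entry T (k + n + 1) k = \<beta> (k + n) * a k - a (k + 1) * \<beta> k"
proof -
  have "blinfun_apply T (basis k) = U_beta \<beta> (blinfun_apply (bshift n o\<^sub>L diag_op a) (basis k))
      - blinfun_apply (bshift n o\<^sub>L diag_op a) (U_beta \<beta> (basis k))"
    using assms(2) basis_finite_vectors unfolding is_commutator_def by blast
  then show ?thesis
    by (simp add: coeff_minus coeff_U_beta basis_finite_vectors finite_vectors_monomial[OF a]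
        coeff_monomial[OF a] basis.rep_eq del: blinfun_apply_blinfun_compose)
qed

text \<open>Converse of the preceding computation: on finite vectors a complex linear operator is
  determined by its entries, here all on diagonal n + 1.\<close>

lemma is_commutator_monomialI:
  assumes a: "bounded (range a)" and T: "complex_linear_op T"
    and zero: "\<And>j k. j \<noteq> k + n + 1 \<Longrightarrow> entry T j k = 0"
    and ent: "\<And>k. entry T (k + n + 1) k = \<beta> (k + n) * a k - a (k + 1) * \<beta> k"
  shows "is_commutator \<beta> (bshift n o\<^sub>L diag_op a) T"
  unfolding is_commutator_def
proof (intro ballI ell2_eqI)
  fix x j assume x: "x \<in> finite_vectors"
  have "coeff (blinfun_apply T x) j = entry T j (j - (n + 1)) * coeff x (j - (n + 1))"
    by (rule coeff_apply_single_diagonal[OF T x]) (use zero in \<open>simp add: add.assoc\<close>)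
  moreover have "entry T j (j - (n + 1)) = \<beta> (j - 1) * a (j - 1 - n) - a (j - n) * \<beta> (j - n - 1)"
    using ent[of "j - (n + 1)"] by (simp add: algebra_simps)
  moreover have "j - (n + 1) = j - 1 - n" "j - n - 1 = j - 1 - n"
    by simp_all
  ultimately show "coeff (blinfun_apply T x) j =
    coeff (U_beta \<beta> (blinfun_apply (bshift n o\<^sub>L diag_op a) x)
      - blinfun_apply (bshift n o\<^sub>L diag_op a) (U_beta \<beta> x)) j"
    using finite_vectors_monomial[OF a x, of n]
    by (simp only: coeff_minus coeff_U_beta x coeff_monomial[OF a] left_diff_distrib mult.assoc)
qed

text \<open>Each monomial occupies its own diagonal, so the n-th diagonal of the sum is the
  coefficient \<open>b n\<close>, or 0 if n is not among the indices.\<close>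

lemma poly_algebra_diagonal:
  assumes "T \<in> poly_algebra"
  shows "(\<lambda>k. entry T (k + n) k) \<in> eventually_constant"
proof -
  obtain F b where F: "finite F" "\<forall>m\<in>F. b m \<in> eventually_constant"
    and T: "T = (\<Sum>m\<in>F. bshift m o\<^sub>L diag_op (b m))"
    using assms unfolding poly_algebra_def by blast
  have "entry T (k + n) k = (\<Sum>m\<in>F. if n = m then b m k else 0)" for k
    unfolding T blinfun.sum_left coeff_sum
    by (rule sum.cong) (use F in \<open>simp_all add: entry_monomial bounded_eventually_constant del: blinfun_apply_blinfun_compose\<close>)
  then have "(\<lambda>k. entry T (k + n) k) = (if n \<in> F then b n else (\<lambda>_. 0))"
    using F(1) by (auto simp: sum.delta')
  moreover have "(\<lambda>_. 0) \<in> eventually_constant"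
    by (simp add: eventually_constant_def)
  ultimately show ?thesis using F(2) by simp
qed

section \<open>The rotation action and covariance\<close>

lemma bounded_range_cis: "bounded (range (\<lambda>k. cis (f k)))"
  by (auto simp: bounded_iff)

lemma entry_rho:
  assumes "complex_linear_op T"
  shows "entry (rho \<theta> T) j k = cis (\<theta> * real_of_int (j - k)) * entry T j k"
  using assms
  by (simp add: rho_def diag_op_apply bounded_range_cis diag_basis coeff_diag_bounded
      complex_linear_op_def cscale.rep_eq cis_mult flip: mult.assoc)
    (simp add: algebra_simps)

lemma rho_monomial:
  assumes a: "bounded (range a)"
  shows "rho \<theta> (bshift n o\<^sub>L diag_op a) =
    scale_op (cis (\<theta> * real_of_int n)) (bshift n o\<^sub>L diag_op a)"
proof (intro blinfun_eqI ell2_eqI)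
  fix x k
  have "coeff (blinfun_apply (rho \<theta> (bshift n o\<^sub>L diag_op a)) x) k =
      cis (\<theta> * real_of_int k) *
        (a (k - n) * (cis (- (\<theta> * real_of_int (k - n))) * coeff x (k - n)))"
    by (simp only: rho_def blinfun_apply_blinfun_compose diag_op_apply[OF bounded_range_cis]
        diag_op_apply[OF a] coeff_diag_bounded[OF bounded_range_cis] coeff_diag_bounded[OF a] coeff_bshift)
  also have "\<dots> = (cis (\<theta> * real_of_int k) * cis (- (\<theta> * real_of_int (k - n)))) *
      (a (k - n) * coeff x (k - n))"
    by (simp only: ac_simps)
  also have "cis (\<theta> * real_of_int k) * cis (- (\<theta> * real_of_int (k - n))) = cis (\<theta> * real_of_int n)"
    by (simp add: cis_mult algebra_simps)
  finally show "coeff (blinfun_apply (rho \<theta> (bshift n o\<^sub>L diag_op a)) x) k =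
    coeff (blinfun_apply (scale_op (cis (\<theta> * real_of_int n)) (bshift n o\<^sub>L diag_op a)) x) k"
    by (simp only: scale_op_apply cscale.rep_eq coeff_monomial[OF a])
qed

text \<open>The monomial is an eigenvector of \<open>rho\<close> with eigenvalue e^(i \<theta> n),
  while \<open>rho\<close> multiplies entry (j, k) by e^(i \<theta> (j-k)). By covariance a nonzero
  entry forces e^(i \<theta> m) = 1 for all admissible \<theta>, where m = j - k - 1 - n is
  nonzero.\<close>

lemma covariant_derivation_entry_zero:
  assumes "derivation r d" "covariant d" and a: "a \<in> eventually_constant"
    and "j \<noteq> k + n + 1"
  shows "entry (d (bshift n o\<^sub>L diag_op a)) j k = 0"
proof (rule ccontr)
  let ?T = "bshift n o\<^sub>L diag_op a" and ?m = "j - k - 1 - n"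
  assume nz: "entry (d ?T) j k \<noteq> 0"
  \<comment> \<open>This angle makes \<theta> m equal to pi or -pi, so the phase is -1 for either
    sign of m; since |m| is at least 1, the angle stays within [0, 2 pi).\<close>
  define \<theta> where "\<theta> = pi / \<bar>real_of_int ?m\<bar>"
  have m: "\<bar>real_of_int ?m\<bar> \<ge> 1" using assms(4) by linarith
  then have "\<theta> \<le> pi"
    unfolding \<theta>_def using mult_left_mono[OF m, of pi] by (simp add: field_simps)
  moreover have "0 \<le> \<theta>" by (simp add: \<theta>_def)
  ultimately have \<theta>: "\<theta> \<in> {0..<2 * pi}" using pi_gt_zero by (simp add: order_le_less_trans[of \<theta> pi])
  have T: "?T \<in> poly_algebra" using poly_algebra_monomial[OF a] .
  have "d ?T \<in> quantum_annulus r" using assms(1) T unfolding derivation_def by blast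
  then have lin: "complex_linear_op (d ?T)" by (rule complex_linear_quantum_annulus)
  have "scale_op (cis (\<theta> * real_of_int n)) (d ?T) = scale_op (cis (- \<theta>)) (rho \<theta> (d ?T))"
    using assms(1,2) T \<theta> rho_monomial[OF bounded_eventually_constant[OF a], of \<theta> n]
    unfolding derivation_def covariant_def by metis
  then have "cis (\<theta> * real_of_int n) * entry (d ?T) j k =
      cis (- \<theta>) * (cis (\<theta> * real_of_int (j - k)) * entry (d ?T) j k)"
    by (metis (no_types) scale_op_apply cscale.rep_eq entry_rho[OF lin])
  then have "cis (\<theta> * real_of_int n) = cis (- \<theta>) * cis (\<theta> * real_of_int (j - k))"
    using nz by simp
  then have "cis (- (\<theta> * real_of_int n)) * cis (\<theta> * real_of_int n) =
      cis (- (\<theta> * real_of_int n)) * (cis (- \<theta>) * cis (\<theta> * real_of_int (j - k)))"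
    by simp
  then have "1 = cis (\<theta> * real_of_int ?m)"
    by (simp add: cis_mult algebra_simps)
  moreover have "pi / \<bar>x\<bar> * x = (if x > 0 then pi else - pi)" if "\<bar>x\<bar> \<ge> 1" for x :: real
    using that by (auto simp: abs_if)
  then have "cis (\<theta> * real_of_int ?m) = -1"
    unfolding \<theta>_def using m by (simp only: complex_eq_iff) simp
  ultimately show False by simp
qed

lemma derivation_zero:
  assumes "derivation r d"
  shows "d 0 = 0"
proof -
  have "0 \<in> poly_algebra"
    unfolding poly_algebra_def by (rule CollectI, intro exI[of _ "{}"]) simp
  then have "d (0 + 0) = d 0 + d 0" using assms unfolding derivation_def by blast
  then show ?thesis by simp
qed

section \<open>Commutator form of a covariant derivation\<close>

lemma covariant_derivation_is_commutator:
  assumes d: "derivation r d" and "covariant d" and "a \<in> poly_algebra"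
  defines "P \<equiv> \<lambda>k::int. bshift 0 o\<^sub>L diag_op (\<lambda>j. if j = k then 1 else 0)"
  defines "\<beta> \<equiv> \<lambda>k. entry (d (P k)) (k + 1) k"
  shows "is_commutator \<beta> a (d a)"
proof -
  have bd: "bounded (range (\<lambda>j::int. if j = k then 1 else 0 :: complex))" for k
    by (rule bounded_eventually_constant[OF delta_eventually_constant])
  have P: "P k \<in> poly_algebra" for k
    unfolding P_def by (rule poly_algebra_monomial[OF delta_eventually_constant])
  have coeff_P: "coeff (blinfun_apply (P k) x) j = (if j = k then coeff x j else 0)" for k x j
    unfolding P_def coeff_monomial[OF bd] by simp
  have P_basis: "blinfun_apply (P k) (basis k) = basis k" for k
    by (rule ell2_eqI) (simp add: coeff_P basis.rep_eq)
  \<comment> \<open>\<open>P k\<close> is a monomial of degree 0, so covariance leaves only diagonal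
    1 of its derivative.\<close>
  have dP: "blinfun_apply (d (P k)) (basis k) = cscale (\<beta> k) (basis (k + 1))" for k
    using covariant_derivation_entry_zero[OF d \<open>covariant d\<close> delta_eventually_constant, of _ k 0 k]
    by (intro ell2_eqI) (simp add: \<beta>_def P_def cscale.rep_eq basis.rep_eq)
  have mono: "is_commutator \<beta> (bshift n o\<^sub>L diag_op b) (d (bshift n o\<^sub>L diag_op b))"
    if b: "b \<in> eventually_constant" for n b
  proof -
    let ?T = "bshift n o\<^sub>L diag_op b"
    have bb: "bounded (range b)" using bounded_eventually_constant[OF b] .
    have T: "?T \<in> poly_algebra" using poly_algebra_monomial[OF b] .
    have "d ?T \<in> quantum_annulus r" using d T unfolding derivation_def by blast
    moreover have "entry (d ?T) (k + n + 1) k = \<beta> (k + n) * b k - b (k + 1) * \<beta> k" for k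
    proof -
      have "?T o\<^sub>L P k = P (k + n) o\<^sub>L ?T"
        by (intro blinfun_eqI ell2_eqI)
          (simp only: blinfun_apply_blinfun_compose[of ?T "P k"]
             blinfun_apply_blinfun_compose[of "P (k + n)" ?T] coeff_P coeff_monomial[OF bb], auto)
      \<comment> \<open>Apply the Leibniz rule to both sides. In row k + n + 1 at E_k the four terms
        are b(k+1) \<beta>(k), the wanted entry of \<open>d ?T\<close>, 0 because
        \<open>P (k + n)\<close> keeps only row k + n, and b(k) \<beta>(k+n).\<close>
      then have "(?T o\<^sub>L d (P k)) + (d ?T o\<^sub>L P k) = (P (k + n) o\<^sub>L d ?T) + (d (P (k + n)) o\<^sub>L ?T)"
        using d T P unfolding derivation_def by metis
      then have "entry ((?T o\<^sub>L d (P k)) + (d ?T o\<^sub>L P k)) (k + n + 1) k =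
          entry ((P (k + n) o\<^sub>L d ?T) + (d (P (k + n)) o\<^sub>L ?T)) (k + n + 1) k"
        by simp
      moreover have "blinfun_apply ?T (basis k) = cscale (b k) (basis (k + n))"
        by (rule ell2_eqI)
          (simp add: entry_monomial[OF bb] cscale.rep_eq basis.rep_eq del: blinfun_apply_blinfun_compose)
      \<comment> \<open>Lets the complex factor b(k) be pulled out of this operator.\<close>
      moreover have "complex_linear_op (d (P (k + n)))"
        using complex_linear_quantum_annulus d P unfolding derivation_def by blast
      ultimately show ?thesis
        unfolding blinfun.add_left plus_ell2.rep_eq blinfun_apply_blinfun_compose[of ?T "d (P k)"]
          blinfun_apply_blinfun_compose[of "d ?T"] blinfun_apply_blinfun_compose[of _ ?T]
          blinfun_apply_blinfun_compose[of _ "d ?T"] P_basis dP coeff_P coeff_monomial[OF bb]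
        by (simp add: complex_linear_op_def dP cscale.rep_eq basis.rep_eq algebra_simps)
    qed
    ultimately show ?thesis
      using covariant_derivation_entry_zero[OF d \<open>covariant d\<close> b, of _ _ n]
      by (intro is_commutator_monomialI bb complex_linear_quantum_annulus) auto
  qed
  obtain F b where F: "finite F" "\<forall>n\<in>F. b n \<in> eventually_constant"
    and a: "a = (\<Sum>n\<in>F. bshift n o\<^sub>L diag_op (b n))"
    using assms(3) unfolding poly_algebra_def by blast
  \<comment> \<open>The same \<beta> serves every monomial, so additivity extends the formula to
    finite sums.\<close>
  have "is_commutator \<beta> (\<Sum>n\<in>F. bshift n o\<^sub>L diag_op (b n)) (d (\<Sum>n\<in>F. bshift n o\<^sub>L diag_op (b n)))"
    using F
  proof (induction F)
    case empty
    have "U_beta \<beta> 0 = 0"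
      by (intro ell2_eqI) (simp add: coeff_U_beta finite_vectors_def zero_ell2.rep_eq)
    then show ?case by (simp add: derivation_zero[OF d] is_commutator_def)
  next
    case (insert n F)
    let ?m = "bshift n o\<^sub>L diag_op (b n)" and ?s = "\<Sum>n\<in>F. bshift n o\<^sub>L diag_op (b n)"
    have "?m \<in> poly_algebra" "?s \<in> poly_algebra"
      using insert poly_algebra_monomial unfolding poly_algebra_def by auto
    moreover from this have "d (?m + ?s) = d ?m + d ?s"
      using d unfolding derivation_def by blast
    ultimately show ?case
      using is_commutator_add[OF mono[of "b n" n], of ?s "d ?s"] insert by simp
  qed
  then show ?thesis using a by simp
qed

section \<open>Uniqueness and increments of \<beta>\<close>

text \<open>For a the projection onto E_k, the entry (k + 1, k) of the commutator is \<beta>(k)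
  itself, so d recovers every value without an additive constant.\<close>

lemma is_commutator_unique:
  assumes "\<forall>a\<in>poly_algebra. is_commutator \<beta> a (d a)" "\<forall>a\<in>poly_algebra. is_commutator \<gamma> a (d a)"
  shows "\<beta> = \<gamma>"
proof
  fix k
  let ?\<delta> = "\<lambda>j::int. if j = k then 1 else 0 :: complex"
  have "bshift 0 o\<^sub>L diag_op ?\<delta> \<in> poly_algebra"
    by (rule poly_algebra_monomial[OF delta_eventually_constant])
  then show "\<beta> k = \<gamma> k"
    using is_commutator_monomial_entry[OF bounded_eventually_constant[OF delta_eventually_constant],
        of \<beta> 0 k "d (bshift 0 o\<^sub>L diag_op ?\<delta>)" k]
      is_commutator_monomial_entry[OF bounded_eventually_constant[OF delta_eventually_constant],
        of \<gamma> 0 k "d (bshift 0 o\<^sub>L diag_op ?\<delta>)" k] assms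
    by simp
qed

lemma const_eventually_constant: "(\<lambda>_. c) \<in> eventually_constant"
  by (auto simp: eventually_constant_def)

text \<open>This reads off [U \<beta>(K), U] = U^2 (\<beta>(K + 1) - \<beta>(K)), with U written as
  a monomial with coefficient 1.\<close>

lemma is_commutator_shift_entry:
  assumes "is_commutator \<beta> (bshift 1 o\<^sub>L diag_op (\<lambda>_. 1)) T"
  shows "entry T (k + 2) k = \<beta> (k + 1) - \<beta> k"
  using is_commutator_monomial_entry[OF bounded_eventually_constant[OF const_eventually_constant] assms, of k]
  by (simp add: add.assoc)

lemma eventually_constant_shift:
  assumes "a \<in> eventually_constant"
  shows "(\<lambda>k. a (k + n)) \<in> eventually_constant"
proof -
  obtain k0 c c' where "\<And>k. k \<ge> k0 \<Longrightarrow> a k = c" "\<And>k. k \<le> -k0 \<Longrightarrow> a k = c'"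
    using assms by (auto simp: eventually_constant_def)
  then show ?thesis by (intro eventually_constantI[of "k0 + \<bar>n\<bar>" _ c c']) auto
qed

theorem proposition3p2:
  fixes r :: real
    and d :: "(ell2 \<Rightarrow>\<^sub>L ell2) \<Rightarrow> (ell2 \<Rightarrow>\<^sub>L ell2)"
  assumes "0 < r" and "r < 1"
    and "derivation r d"
    and "covariant d"
  shows "(\<exists>!\<beta>. \<beta> \<in> c_inc \<and> (\<forall>a\<in>poly_algebra. is_commutator \<beta> a (d a))) \<and>
    (d ` poly_algebra \<subseteq> poly_algebra \<longrightarrow>
      (\<forall>\<beta>. \<beta> \<in> c_inc \<and> (\<forall>a\<in>poly_algebra. is_commutator \<beta> a (d a)) \<longrightarrow>
        eventually_linear \<beta>))"
proof -
  let ?U = "bshift 1 o\<^sub>L diag_op (\<lambda>_. 1)"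
  have U: "?U \<in> poly_algebra"
    by (rule poly_algebra_monomial[OF const_eventually_constant])
  \<comment> \<open>The backward increment is diagonal 2 of \<open>d ?U\<close> at k - 1; writing
    the index as \<open>k + (- 1)\<close> matches the shift lemmas.\<close>
  have increments: "(\<lambda>k. \<beta> k - \<beta> (k - 1)) = (\<lambda>k. entry (d ?U) ((k + (- 1)) + 2) (k + (- 1)))"
    if "\<forall>a\<in>poly_algebra. is_commutator \<beta> a (d a)" for \<beta>
  proof -
    have "entry (d ?U) (k + 2) k = \<beta> (k + 1) - \<beta> k" for k
      using that U by (intro is_commutator_shift_entry) blast
    then show ?thesis by (simp only:) simp
  qed
  obtain \<beta> where \<beta>: "\<forall>a\<in>poly_algebra. is_commutator \<beta> a (d a)"
    using covariant_derivation_is_commutator[OF assms(3,4)] by blast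
  have "d ?U \<in> quantum_annulus r"
    using assms(3) U unfolding derivation_def by blast
  from c_Z_shift[OF quantum_annulus_diagonal[OF this, of 2], of "- 1"]
  have "\<beta> \<in> c_inc" unfolding c_inc_def mem_Collect_eq increments[OF \<beta>] .
  then have "\<exists>!\<beta>. \<beta> \<in> c_inc \<and> (\<forall>a\<in>poly_algebra. is_commutator \<beta> a (d a))"
    using \<beta> is_commutator_unique by blast
  \<comment> \<open>The increments lie on the same diagonal of \<open>d ?U\<close>, which is
    eventually constant once \<open>d ?U\<close> is in \<open>poly_algebra\<close>.\<close>
  moreover have "eventually_linear \<beta>"
    if "d ` poly_algebra \<subseteq> poly_algebra" "\<forall>a\<in>poly_algebra. is_commutator \<beta> a (d a)" for \<beta>
  proof -
    have "d ?U \<in> poly_algebra" using that(1) U by blast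
    from eventually_constant_shift[OF poly_algebra_diagonal[OF this, of 2], of "- 1"]
    show ?thesis unfolding eventually_linear_def increments[OF that(2)] .
  qed
  ultimately show ?thesis by blast
qed

end
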